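(* For $n\ge1$ let $\Gamma_n$ be the Schreier graph at level $n$ of the Hanoi Towers group $H^{(3)}$ on 3 pegs. For any $1\le p<\infty$ the $\ell_p$-distortion of the sequence $\{\Gamma_n\}$ is uniformly bounded above; that is, there is a constant $D<\infty$ such that $c_{(p)}(\Gamma_n)\le D$ for all $n\ge 1$.
   Context: Hanoi Towers group: on finite words over the alphabet $\{0,1,2\}$ (the vertices of the rooted ternary tree), for $i\ne j$ in $\{0,1,2\}$ and $x\in\{0,1,2\}\setminus\{i,j\}$ define recursively the automorphism $a_{(ij)}$ by $a_{(ij)}(iw)=jw$, $a_{(ij)}(jw)=iw$, $a_{(ij)}(xw)=x\,a_{(ij)}(w)$ for every word $w$, with the empty word fixed. Put $a=a_{(01)}$, $b=a_{(02)}$, $c=a_{(12)}$ (each an involution); $H^{(3)}$ is the group they generate. $\Gamma_n$ is the Schreier graph of the stabilizer $P_n=\mathrm{st}_{H^{(3)}}(1^n)$ with respect to $\{a,b,c\}$; equivalently, since the action on each level is transitive, its vertex set is the set of $3^n$ words of length $n$ over $\{0,1,2\}$, with $w$ joined to $s(w)$ by an edge for each $s\in\{a,b,c\}$ (giving a loop when $s(w)=w$). The vertex set is equipped with the combinatorial (shortest path) metric $d$. $\ell_p$-distortion: for a finite metric space $X$ with at least two points, $c_{(p)}(X)=\inf_f L_f$, where the infimum is over all one-to-one maps $f:X\to\ell_p(\mathbb{N})$ (real $\ell_p$) that are 1-Lipschitz, i.e. $\|f(x)-f(y)\|_p\le d(x,y)$ for all $x,y$, and $L_f=\max_{x\ne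 y}\frac{d(x,y)}{\|f(x)-f(y)\|_p}$. For a graph, $c_{(p)}(\Gamma)$ is $c_{(p)}$ of its vertex set. *)

theory Defs
  imports
    "HOL-Analysis.Analysis"
    "HOL-Algebra.Generated_Groups"
    "HOL-Algebra.Group_Action"
    "HOL-Algebra.Left_Coset"
begin

(* The three pegs are the elements 0, 1, 2 of the type 3 (so 0 = 3), and the vertices of the
   rooted ternary tree are all elements of the type 3 list. *)

fun peg_swap :: "3 \<Rightarrow> 3 \<Rightarrow> 3 list \<Rightarrow> 3 list" where
  "peg_swap i j [] = []"
| "peg_swap i j (x # w) =
     (if x = i then j # w else if x = j then i # w else x # peg_swap i j w)"

definition hanoi_gens :: "(3 list \<Rightarrow> 3 list) set" where
  "hanoi_gens = {peg_swap 0 1, peg_swap 0 2, peg_swap 1 2}"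

(* In BijGroup, g \<otimes> f is "first f, then g", so the group acts on words from the left. *)
definition hanoi_group :: "(3 list \<Rightarrow> 3 list) monoid" where
  "hanoi_group = subgroup_generated (BijGroup UNIV) hanoi_gens"

(* subgroup_generated discards generators outside the carrier; no generator is lost here. *)
lemma hanoi_gens_carrier: "hanoi_gens \<subseteq> carrier (BijGroup UNIV)"
proof -
  have "peg_swap i j \<circ> peg_swap i j = id" for i j
  proof
    fix w show "(peg_swap i j \<circ> peg_swap i j) w = id w"
      by (induction w) auto
  qed
  then have "bij (peg_swap i j)" for i j
    using o_bij by blast
  then show ?thesis
    by (auto simp: hanoi_gens_def BijGroup_def Bij_def)
qed

definition hanoi_stab :: "nat \<Rightarrow> (3 list \<Rightarrow> 3 list) set" where
  "hanoi_stab n = stabilizer hanoi_group (\<lambda>g. g) (replicate n 1)"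

(* The Schreier graph of P with respect to S has vertex set lcosets P. Left cosets, because with
   a left action g P corresponds to the point g(v), where P is the stabilizer of v; the edge
   labelled s then joins it to s g P. The edge relation is symmetrized since the graph is
   undirected; loops and multiplicities of edges do not affect the path metric. *)
definition schreier_edges :: "('g, 'm) monoid_scheme \<Rightarrow> 'g set \<Rightarrow> 'g set \<Rightarrow> ('g set \<times> 'g set) set"
  where "schreier_edges G P S =
    (let E = {(C, s <#\<^bsub>G\<^esub> C) | C s. C \<in> lcosets\<^bsub>G\<^esub> P \<and> s \<in> S} in E \<union> E\<inverse>)"

(* Unspecified when x and y lie in different components. *)
definition path_dist :: "('v \<times> 'v) set \<Rightarrow> 'v \<Rightarrow> 'v \<Rightarrow> real" where
  "path_dist E x y = real (LEAST k. (x, y) \<in> E ^^ k)"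

definition hanoi_vertices :: "nat \<Rightarrow> (3 list \<Rightarrow> 3 list) set set" where
  "hanoi_vertices n = lcosets\<^bsub>hanoi_group\<^esub> (hanoi_stab n)"

definition hanoi_dist ::
    "nat \<Rightarrow> (3 list \<Rightarrow> 3 list) set \<Rightarrow> (3 list \<Rightarrow> 3 list) set \<Rightarrow> real" where
  "hanoi_dist n = path_dist (schreier_edges hanoi_group (hanoi_stab n) hanoi_gens)"

definition lp_space :: "real \<Rightarrow> (nat \<Rightarrow> real) set" where
  "lp_space p = {u. summable (\<lambda>k. \<bar>u k\<bar> powr p)}"

definition lp_norm :: "real \<Rightarrow> (nat \<Rightarrow> real) \<Rightarrow> real" where
  "lp_norm p u = (\<Sum>k. \<bar>u k\<bar> powr p) powr (1 / p)"

definition lp_dist :: "real \<Rightarrow> (nat \<Rightarrow> real) \<Rightarrow> (nat \<Rightarrow> real) \<Rightarrow> real" where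
  "lp_dist p u v = lp_norm p (\<lambda>k. u k - v k)"

definition lp_embeddings ::
    "real \<Rightarrow> 'v set \<Rightarrow> ('v \<Rightarrow> 'v \<Rightarrow> real) \<Rightarrow> ('v \<Rightarrow> nat \<Rightarrow> real) set" where
  "lp_embeddings p X d =
    {f \<in> X \<rightarrow> lp_space p. inj_on f X \<and> (\<forall>x\<in>X. \<forall>y\<in>X. lp_dist p (f x) (f y) \<le> d x y)}"

(* Meaningful for finite X with at least two points, where the maximum is over a finite
   nonempty set. *)
definition inv_lipschitz ::
    "real \<Rightarrow> 'v set \<Rightarrow> ('v \<Rightarrow> 'v \<Rightarrow> real) \<Rightarrow> ('v \<Rightarrow> nat \<Rightarrow> real) \<Rightarrow> real" where
  "inv_lipschitz p X d f =
    Max {d x y / lp_dist p (f x) (f y) | x y. x \<in> X \<and> y \<in> X \<and> x \<noteq> y}"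

(* Extended-real valued, so that the infimum over an empty set of embeddings would be infinite. *)
definition lp_distortion :: "real \<Rightarrow> 'v set \<Rightarrow> ('v \<Rightarrow> 'v \<Rightarrow> real) \<Rightarrow> ereal" where
  "lp_distortion p X d = (INF f\<in>lp_embeddings p X d. ereal (inv_lipschitz p X d f))"

end

theory Submission
  imports Defs
begin

text \<open>
  The distances from a configuration of the Hanoi puzzle to its three corners, the words
  \<open>i\<^sup>n\<close> in which all disks lie on peg \<open>i\<close>, are already the coordinates of an embedding with
  bounded distortion. Geometrically, the Schreier graph looks like a discrete Sierpinski gasket
  and these are its barycentric coordinates, each subtracted from its maximum.

  The map does not expand, since an edge changes the distance to a corner by at most one. For the
  converse, let \<open>v = v' x z\<close> and \<open>w = w' y z\<close> be words whose last difference is \<open>x \<noteq> y\<close>, at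
  position \<open>m + 1\<close>, and let \<open>t\<close> be the third peg. The common part \<open>z\<close> of large disks only
  permutes the names of the corners and shifts the coordinates, so take \<open>z\<close> empty. The two copies
  of the graph of level \<open>m\<close> that contain \<open>v\<close> and \<open>w\<close> are joined by an edge between their corners
  \<open>t\<^sup>m x\<close> and \<open>t\<^sup>m y\<close>. Going through it gives a path of length \<open>d(v', t\<^sup>m) + 1 + d(w', t\<^sup>m)\<close>.
  On the other hand \<open>d(v, y\<^sup>m\<^sup>+\<^sup>1) = d(v', t\<^sup>m) + 2\<^sup>m\<close>, as all smaller disks have to be gathered on
  \<open>t\<close> before the disk in position \<open>m + 1\<close> can move, while \<open>d(w, y\<^sup>m\<^sup>+\<^sup>1) = d(w', y\<^sup>m) < 2\<^sup>m\<close>. So the coordinates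
  of \<open>y\<close> differ by more than \<open>d(v', t\<^sup>m)\<close>, those of \<open>x\<close> by more than \<open>d(w', t\<^sup>m)\<close>, and the larger
  of these differences is at least half of the length of the path
  (\<open>moves_le_corner_dist_diff\<close>).

  The three coordinates are given by a recursion over the word (\<open>corner_dist\<close>). That they change
  by at most one along an edge (\<open>corner_dist_peg_swap\<close>) follows from a quantity that is invariant
  under a generator (\<open>peg_swap_invariant\<close>); that they bound the length of some path to the
  corner is the usual strategy for the puzzle (\<open>moves_to_corner\<close>). All this takes place on words;
  it carries over to the cosets of the stabilizer of \<open>1\<^sup>n\<close> because such a coset consists of all
  group elements that send \<open>1\<^sup>n\<close> to a fixed word (\<open>l_coset_fibre\<close>). Dividing the coordinates by
  their number 3 makes the map 1-Lipschitz for every \<open>p\<close> and gives distortion at most \<open>2 * 3\<close>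
  (\<open>lp_distortion_le_coordinates\<close>), so that one bound serves for all \<open>n\<close>.
\<close>

section \<open>The third peg\<close>

lemma peg_cases: "(i :: 3) = 0 \<or> i = 1 \<or> i = 2"
proof -
  have "(3 :: 3) = 0" by simp
  then show ?thesis using exhaust_3[of i] by metis
qed

text \<open>
  The pegs form the integers modulo 3, where \<open>x + y + z = 0\<close> holds for three distinct and for
  three equal elements. Hence this formula is the peg other than \<open>x\<close> and \<open>y\<close> if these differ, and
  \<open>x\<close> if they agree. Both cases occur in the strategy for the puzzle, and one formula for them
  spares the case distinctions.
\<close>

definition third_peg :: "3 \<Rightarrow> 3 \<Rightarrow> 3" where
  "third_peg x y = - (x + y)"

lemma third_peg_commute: "third_peg x y = third_peg y x"
  by (simp add: third_peg_def)

lemma third_peg_involution [simp]: "third_peg (third_peg x y) y = x"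
  by (simp add: third_peg_def)

lemma third_peg_left_cancel [simp]: "third_peg x y = third_peg x z \<longleftrightarrow> y = z"
  by (simp add: third_peg_def)

lemma third_peg_self [simp]: "third_peg x x = x"
proof -
  have "(3 :: 3) = 0" by simp
  have "x + x + x = 3 * x" by (simp add: algebra_simps)
  also have "\<dots> = 0" unfolding \<open>(3 :: 3) = 0\<close> by simp
  finally have "- (x + x) = x" by (rule minus_unique)
  then show ?thesis by (simp only: third_peg_def)
qed

lemma third_peg_neq:
  assumes "x \<noteq> y"
  shows "third_peg x y \<noteq> x" "third_peg x y \<noteq> y"
  by (metis assms third_peg_commute third_peg_left_cancel third_peg_self)+

lemma third_peg_unique:
  assumes "x \<noteq> a" "x \<noteq> b" "a \<noteq> b"
  shows "x = third_peg a b"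
  using assms peg_cases[of x] peg_cases[of a] peg_cases[of b]
  by (elim disjE) (simp_all add: third_peg_def eq_neg_iff_add_eq_0)

section \<open>Distances to the corners\<close>

text \<open>
  Letters describe disks from the smallest to the largest. If the letters of \<open>w\<close> are the positions
  of the larger disks and the whole tower is to be built on peg \<open>i\<close>, then \<open>peg_goal w i\<close> is the peg
  on which the next smaller disk has to be at first. A disk that is already on its goal keeps the
  goal for the smaller ones; any other disk can only move once they are on the third peg.
\<close>

fun peg_goal :: "3 list \<Rightarrow> 3 \<Rightarrow> 3" where
  "peg_goal [] i = i"
| "peg_goal (x # w) i = third_peg (peg_goal w i) x"

text \<open>
  The length of a shortest path from \<open>w\<close> to the word with all letters \<open>i\<close>. The disk in position
  \<open>k\<close> (counted from 0) adds \<open>2\<^sup>k\<close> if it is not on its goal: one step moves it and \<open>2\<^sup>k - 1\<close> steps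
  bring the smaller tower back on top of it. The factor 2 in the recursion accounts for the shift
  of positions by a new smallest disk.
\<close>

fun corner_dist :: "3 list \<Rightarrow> 3 \<Rightarrow> nat" where
  "corner_dist [] i = 0"
| "corner_dist (x # w) i = 2 * corner_dist w i + of_bool (x \<noteq> peg_goal w i)"

lemma length_peg_swap [simp]: "length (peg_swap a b w) = length w"
  by (induction w) auto

lemma peg_swap_involution [simp]: "peg_swap a b (peg_swap a b w) = w"
  by (induction w) auto

lemma peg_swap_commute: "peg_swap a b w = peg_swap b a w"
  by (induction w) auto

lemma peg_swap_append: "peg_swap a b w \<noteq> w \<Longrightarrow> peg_swap a b (w @ u) = peg_swap a b w @ u"
  by (induction w) auto

text \<open>
  If the first letter is \<open>t\<close>, which
  the swap of \<open>a\<close> and \<open>b\<close> passes over, then putting \<open>t\<close> in front doubles the quantity. If it is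
  \<open>a\<close> or \<open>b\<close>, the rest of the word does not move, and with the goal \<open>g\<close> of that letter the
  quantity counts, apart from terms of the rest, which of \<open>g \<noteq> a\<close> and \<open>g \<noteq> b\<close> hold; this is
  symmetric in \<open>a\<close> and \<open>b\<close>.
\<close>

lemma peg_swap_invariant:
  assumes "a \<noteq> b"
  defines "t \<equiv> third_peg a b"
  shows "corner_dist (peg_swap a b w) i + of_bool (peg_goal (peg_swap a b w) i \<noteq> t)
       = corner_dist w i + of_bool (peg_goal w i \<noteq> t)"
proof (induction w)
  case (Cons x w)
  have a: "third_peg g a = t \<longleftrightarrow> g = b" and b: "third_peg g b = t \<longleftrightarrow> g = a" for g
    by (metis t_def third_peg_commute third_peg_left_cancel)+
  have t: "third_peg g t = t \<longleftrightarrow> g = t" for g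
    by (metis third_peg_involution third_peg_self)
  consider "x = a" | "x = b" "x \<noteq> a" | "x = t" "x \<noteq> a" "x \<noteq> b"
    using third_peg_unique[of x a b] assms(1) unfolding t_def by blast
  then show ?case
  proof cases
    case 3
    then have "corner_dist (peg_swap a b (x # w)) i + of_bool (peg_goal (peg_swap a b (x # w)) i \<noteq> t)
        = 2 * (corner_dist (peg_swap a b w) i + of_bool (peg_goal (peg_swap a b w) i \<noteq> t))"
      by (simp add: t of_bool_def)
    also have "\<dots> = corner_dist (x # w) i + of_bool (peg_goal (x # w) i \<noteq> t)"
      unfolding Cons.IH using 3 by (simp add: t of_bool_def)
    finally show ?thesis .
  qed (auto simp: a b of_bool_def)
qed simp

text \<open>By the invariant, distances change only as much as a truth value does.\<close>

lemma corner_dist_peg_swap: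
  assumes "a \<noteq> b"
  shows "\<bar>real (corner_dist (peg_swap a b w) i) - real (corner_dist w i)\<bar> \<le> 1"
  using peg_swap_invariant[OF assms, of w i] by (auto simp: of_bool_def split: if_splits)

text \<open>
  A new largest disk on peg \<open>x\<close> turns the corner \<open>i\<close> into the corner \<open>third_peg i x\<close> for the
  remaining disks. This is the self-similar structure of the graph: level \<open>n + 1\<close> consists of three
  copies of level \<open>n\<close>, one for each last letter.
\<close>

lemma peg_goal_snoc: "peg_goal (w @ [x]) i = peg_goal w (third_peg i x)"
  by (induction w) auto

lemma corner_dist_snoc:
  "corner_dist (w @ [x]) i = corner_dist w (third_peg i x) + of_bool (x \<noteq> i) * 2 ^ length w"
  by (induction w) (auto simp: peg_goal_snoc)

lemma corner_dist_less: "corner_dist w i < 2 ^ length w"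
  by (induction w) auto

section \<open>Short paths between words\<close>

text \<open>
  With the trivial step included, the \<open>k\<close>-th power of the relation holds if there is a path of
  length at most \<open>k\<close>. This also makes the relation stable under appending letters, although a
  generator that fixes a word may change a later letter of a longer one.
\<close>

definition moves :: "(3 list \<times> 3 list) set" where
  "moves = {(w, w'). w' = w \<or> (\<exists>a b. a \<noteq> b \<and> w' = peg_swap a b w)}"

lemma moves_refl [simp]: "(w, w) \<in> moves"
  by (simp add: moves_def)

lemma peg_swap_moves: "a \<noteq> b \<Longrightarrow> (w, peg_swap a b w) \<in> moves"
  by (auto simp: moves_def)

lemma moves_cases:
  assumes "(v, w) \<in> moves"
  obtains "w = v" | a b where "a \<noteq> b" "w = peg_swap a b v"
  using assms unfolding moves_def by blast

lemma moves_sym: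
  assumes "(v, w) \<in> moves"
  shows "(w, v) \<in> moves"
  using assms
proof (cases rule: moves_cases)
  case (2 a b)
  then show ?thesis using peg_swap_moves[of a b w] by simp
qed simp

lemma relpow_image:
  assumes "\<And>x y. (x, y) \<in> R \<Longrightarrow> (f x, f y) \<in> S" and "(x, y) \<in> R ^^ k"
  shows "(f x, f y) \<in> S ^^ k"
  using assms(2) by (induction k arbitrary: y) (auto intro: assms(1))

lemma relpow_sym:
  assumes "\<And>x y. (x, y) \<in> R \<Longrightarrow> (y, x) \<in> R" and "(x, y) \<in> R ^^ k"
  shows "(y, x) \<in> R ^^ k"
  using assms(2)
proof (induction k arbitrary: y)
  case (Suc k)
  then obtain z where "(x, z) \<in> R ^^ k" "(z, y) \<in> R" by auto
  then show ?case using Suc.IH assms(1) by (meson relpow_Suc_I2)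
qed simp

lemma relpow_refl_mono:
  assumes "\<And>x. (x, x) \<in> R" and "(x, y) \<in> R ^^ k" and "k \<le> m"
  shows "(x, y) \<in> R ^^ m"
  using assms(3,2)
  by (induction rule: dec_induct) (use assms(1) in auto)

lemma moves_append:
  assumes "(v, w) \<in> moves"
  shows "(v @ u, w @ u) \<in> moves"
  using assms
proof (cases rule: moves_cases)
  case (2 a b)
  show ?thesis
  proof (cases "w = v")
    case False
    with 2 have "w @ u = peg_swap a b (v @ u)" by (simp add: peg_swap_append)
    with 2 show ?thesis using peg_swap_moves[of a b "v @ u"] by simp
  qed simp
qed simp

lemma moves_relpow_append: "(v, w) \<in> moves ^^ k \<Longrightarrow> (v @ u, w @ u) \<in> moves ^^ k"
  by (rule relpow_image[of moves "\<lambda>w. w @ u"]) (rule moves_append)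

lemma moves_last_letter:
  assumes "x \<noteq> y"
  shows "(replicate n (third_peg x y) @ [x], replicate n (third_peg x y) @ [y]) \<in> moves"
proof -
  have "peg_swap x y (replicate n (third_peg x y) @ [x]) = replicate n (third_peg x y) @ [y]"
    using third_peg_neq[OF assms] by (induction n) auto
  then show ?thesis using peg_swap_moves[OF assms] by metis
qed

text \<open>
  The strategy for the puzzle: gather the smaller disks on the third peg \<open>t\<close>, move the largest
  disk, and move the smaller tower onto it. The last part costs at most \<open>2\<^sup>n - 1\<close> by the induction
  hypothesis for the word \<open>t\<^sup>n\<close>.
\<close>

lemma moves_to_corner:
  "(w, replicate (length w) i) \<in> moves ^^ corner_dist w i"
proof (induction "length w" arbitrary: w i)
  case (Suc n)
  obtain v x where w: "w = v @ [x]" and n: "n = length v"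
    using Suc.hyps(2) by (metis length_Suc_conv_rev)
  define t where "t = third_peg x i"
  have v: "(w, replicate n t @ [x]) \<in> moves ^^ corner_dist v t"
    unfolding w n by (rule moves_relpow_append) (use Suc.hyps(1)[OF n] n in simp)
  show ?case
  proof (cases "x = i")
    case True
    then have "t = i" by (simp add: t_def)
    with v True show ?thesis by (simp add: w n corner_dist_snoc replicate_append_same)
  next
    case False
    \<comment> \<open>Padding to the largest possible number of steps gives the length in \<open>corner_dist_snoc\<close>.\<close>
    have "(replicate n t, replicate n i) \<in> moves ^^ corner_dist (replicate n t) i"
      using Suc.hyps(1)[of "replicate n t" i] by simp
    then have "(replicate n t, replicate n i) \<in> moves ^^ (2 ^ n - 1)"
      by (rule relpow_refl_mono[rotated]) (use corner_dist_less[of "replicate n t" i] in auto)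
    then have "(replicate n t @ [i], replicate n i @ [i]) \<in> moves ^^ (2 ^ n - 1)"
      by (rule moves_relpow_append)
    moreover have "(replicate n t @ [x], replicate n t @ [i]) \<in> moves ^^ 1"
      using moves_last_letter[OF False] by (simp add: t_def)
    ultimately have "(w, replicate n i @ [i]) \<in> moves ^^ (corner_dist v t + (1 + (2 ^ n - 1)))"
      using v by (meson relpow_trans)
    with False show ?thesis
      by (simp add: w n corner_dist_snoc replicate_append_same t_def third_peg_commute)
  qed
qed simp

text \<open>
  The reverse inequality for the embedding, by induction on the length of the common suffix. A
  common last letter only renames the corner that separates the words. At distinct last letters
  \<open>x\<close> and \<open>y\<close>, the path through the edge between the two copies is compared with the corners \<open>x\<close>
  and \<open>y\<close>.
\<close>

lemma moves_le_corner_dist_diff: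
  assumes "length v = length w"
  shows "\<exists>i k. (v, w) \<in> moves ^^ k \<and>
           real k \<le> 2 * \<bar>real (corner_dist v i) - real (corner_dist w i)\<bar>"
  using assms
proof (induction "length v" arbitrary: v w)
  case 0
  then show ?case by (auto intro!: exI[of _ "0::nat"])
next
  case (Suc n)
  obtain v' x where v: "v = v' @ [x]" and lv: "n = length v'"
    using Suc.hyps(2) by (metis length_Suc_conv_rev)
  obtain w' y where w: "w = w' @ [y]" and lw: "n = length w'"
    using Suc.hyps(2) Suc.prems by (metis length_Suc_conv_rev)
  show ?case
  proof (cases "x = y")
    case True
    obtain i k where k: "(v', w') \<in> moves ^^ k"
      "real k \<le> 2 * \<bar>real (corner_dist v' i) - real (corner_dist w' i)\<bar>"
      using Suc.hyps(1)[OF lv] lv lw by metis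
    have "(v, w) \<in> moves ^^ k"
      unfolding v w True by (rule moves_relpow_append) (rule k(1))
    moreover have "real k \<le> 2 * \<bar>real (corner_dist v (third_peg i x)) - real (corner_dist w (third_peg i x))\<bar>"
      using k(2) lv lw unfolding v w True corner_dist_snoc third_peg_involution by simp
    ultimately show ?thesis by blast
  next
    case False
    define t where "t = third_peg x y"
    have "(v, replicate n t @ [x]) \<in> moves ^^ corner_dist v' t"
      unfolding v lv by (rule moves_relpow_append) (rule moves_to_corner)
    moreover have "(replicate n t @ [x], replicate n t @ [y]) \<in> moves ^^ 1"
      using moves_last_letter[OF False] by (simp add: t_def)
    moreover have "(w, replicate n t @ [y]) \<in> moves ^^ corner_dist w' t"
      unfolding w lw by (rule moves_relpow_append) (rule moves_to_corner)
    then have "(replicate n t @ [y], w) \<in> moves ^^ corner_dist w' t"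
      by (rule relpow_sym[rotated]) (rule moves_sym)
    ultimately have path: "(v, w) \<in> moves ^^ (corner_dist v' t + (1 + corner_dist w' t))"
      by (meson relpow_trans)
    have "corner_dist v y = corner_dist v' t + 2 ^ n" "corner_dist w y = corner_dist w' y"
      "corner_dist w x = corner_dist w' t + 2 ^ n" "corner_dist v x = corner_dist v' x"
      using False by (simp_all add: v w corner_dist_snoc lv[symmetric] lw[symmetric] t_def third_peg_commute)
    moreover have "corner_dist w' y + 1 \<le> 2 ^ n" "corner_dist v' x + 1 \<le> 2 ^ n"
      using corner_dist_less[of w' y] corner_dist_less[of v' x] lv lw by simp_all
    ultimately have "corner_dist w y + (1 + corner_dist v' t) \<le> corner_dist v y"
      "corner_dist v x + (1 + corner_dist w' t) \<le> corner_dist w x"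
      by linarith+
    then have le: "1 + real (corner_dist v' t) \<le> real (corner_dist v y) - real (corner_dist w y)"
      "1 + real (corner_dist w' t) \<le> real (corner_dist w x) - real (corner_dist v x)"
      by linarith+
    \<comment> \<open>The two differences sum up to more than the length of the path: the larger one is enough.\<close>
    show ?thesis
    proof (cases "corner_dist w' t \<le> corner_dist v' t")
      case True
      then have "real (corner_dist w' t) \<le> real (corner_dist v' t)" by simp
      then have "real (corner_dist v' t + (1 + corner_dist w' t))
          \<le> 2 * \<bar>real (corner_dist v y) - real (corner_dist w y)\<bar>"
        using le(1) by simp
      then show ?thesis using path by blast
    next
      case False
      then have "real (corner_dist v' t) \<le> real (corner_dist w' t)" by simp
      then have "real (corner_dist v' t + (1 + corner_dist w' t))
          \<le> 2 * \<bar>real (corner_dist v x) - real (corner_dist w x)\<bar>"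
        using le(2) by simp
      then show ?thesis using path by blast
    qed
  qed
qed

section \<open>The Schreier graph as a graph on words\<close>

lemma hanoi_gens_eq: "hanoi_gens = {peg_swap a b | a b. a \<noteq> b}"
proof (intro equalityI subsetI)
  fix s assume "s \<in> hanoi_gens"
  then consider "s = peg_swap 0 1" | "s = peg_swap 0 2" | "s = peg_swap 1 2"
    unfolding hanoi_gens_def by blast
  moreover have "(0::3) \<noteq> 1" "(0::3) \<noteq> 2" "(1::3) \<noteq> 2" by simp_all
  ultimately show "s \<in> {peg_swap a b | a b. a \<noteq> b}"
    by cases blast+
next
  fix s assume "s \<in> {peg_swap a b | a b. a \<noteq> b}"
  then obtain a b where ab: "a \<noteq> b" "s = peg_swap a b" by blast
  have "peg_swap 1 0 = peg_swap 0 1" "peg_swap 2 0 = peg_swap 0 2" "peg_swap 2 1 = peg_swap 1 2"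
    by (rule ext, rule peg_swap_commute)+
  with ab show "s \<in> hanoi_gens"
    using peg_cases[of a] peg_cases[of b]
    by (elim disjE) (simp_all add: hanoi_gens_def)
qed

lemma group_hanoi_group: "group hanoi_group"
  unfolding hanoi_group_def by (rule group.group_subgroup_generated[OF group_BijGroup])

lemma hanoi_group_subset_Bij: "carrier hanoi_group \<subseteq> Bij UNIV"
  using group.carrier_subgroup_generated_subset[OF group_BijGroup]
  unfolding hanoi_group_def by (simp add: BijGroup_def)

lemma hanoi_gens_subset: "hanoi_gens \<subseteq> carrier hanoi_group"
  unfolding hanoi_group_def
  using group.subgroup_generated_subset_carrier_subset[OF group_BijGroup hanoi_gens_carrier] .

lemma peg_swap_in_hanoi_group: "a \<noteq> b \<Longrightarrow> peg_swap a b \<in> carrier hanoi_group"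
  using hanoi_gens_subset by (auto simp: hanoi_gens_eq)

lemma hanoi_mult_apply:
  assumes "g \<in> carrier hanoi_group" "f \<in> carrier hanoi_group"
  shows "(g \<otimes>\<^bsub>hanoi_group\<^esub> f) w = g (f w)"
proof -
  have "g \<in> Bij UNIV" "f \<in> Bij UNIV"
    using assms hanoi_group_subset_Bij by auto
  then show ?thesis
    by (simp add: hanoi_group_def BijGroup_def compose_def)
qed

lemma hanoi_one_apply: "\<one>\<^bsub>hanoi_group\<^esub> w = w"
  by (simp add: hanoi_group_def BijGroup_def)

lemma hanoi_inv_apply:
  assumes "g \<in> carrier hanoi_group"
  shows "(inv\<^bsub>hanoi_group\<^esub> g) (g w) = w" "g ((inv\<^bsub>hanoi_group\<^esub> g) w) = w"
proof -
  interpret group hanoi_group by (rule group_hanoi_group)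
  show "(inv\<^bsub>hanoi_group\<^esub> g) (g w) = w" "g ((inv\<^bsub>hanoi_group\<^esub> g) w) = w"
    using assms by (metis hanoi_mult_apply hanoi_one_apply inv_closed l_inv r_inv)+
qed

lemma hanoi_length:
  assumes "g \<in> carrier hanoi_group"
  shows "length (g w) = length w"
proof -
  have gens: "length (h w) = length w" if "h \<in> hanoi_gens" for h w
    using that by (auto simp: hanoi_gens_eq)
  have "g \<in> generate (BijGroup UNIV) hanoi_gens"
    using assms hanoi_gens_carrier
    by (simp add: hanoi_group_def carrier_subgroup_generated Int_absorb1)
  then have "g \<in> carrier hanoi_group \<and> (\<forall>w. length (g w) = length w)"
  proof induction
    case one
    interpret group hanoi_group by (rule group_hanoi_group)
    show ?case using one_closed hanoi_one_apply
      by (metis hanoi_group_def one_subgroup_generated)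
  next
    case (incl h)
    then show ?case using gens hanoi_gens_subset by auto
  next
    case (inv h)
    interpret group hanoi_group by (rule group_hanoi_group)
    have h: "h \<in> carrier hanoi_group" using inv hanoi_gens_subset by auto
    then have "inv\<^bsub>BijGroup UNIV\<^esub> h = inv\<^bsub>hanoi_group\<^esub> h"
      unfolding hanoi_group_def by (simp add: group.inv_subgroup_generated[OF group_BijGroup])
    moreover have "length ((inv\<^bsub>hanoi_group\<^esub> h) w) = length w" for w
      using gens[OF inv] hanoi_inv_apply(2)[OF h] by metis
    ultimately show ?case using h by simp
  next
    case (eng h1 h2)
    interpret group hanoi_group by (rule group_hanoi_group)
    have "h1 \<otimes>\<^bsub>BijGroup UNIV\<^esub> h2 = h1 \<otimes>\<^bsub>hanoi_group\<^esub> h2"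
      by (simp add: hanoi_group_def)
    moreover have "h1 \<otimes>\<^bsub>hanoi_group\<^esub> h2 \<in> carrier hanoi_group"
      using eng.IH m_closed by blast
    ultimately show ?case using eng.IH hanoi_mult_apply by metis
  qed
  then show ?thesis by blast
qed

text \<open>
  Paths between words are group elements; together with the paths to the corners this shows that the
  group acts transitively on each level.
\<close>

lemma moves_in_orbit:
  assumes "(v, w) \<in> moves ^^ k"
  shows "\<exists>g\<in>carrier hanoi_group. w = g v"
  using assms
proof (induction k arbitrary: w)
  case 0
  interpret group hanoi_group by (rule group_hanoi_group)
  show ?case using 0 hanoi_one_apply[of v] one_closed by (metis relpow_0_E)
next
  case (Suc k)
  interpret group hanoi_group by (rule group_hanoi_group)
  obtain u where "(v, u) \<in> moves ^^ k" and u: "(u, w) \<in> moves" using Suc.prems by auto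
  then obtain g where g: "g \<in> carrier hanoi_group" "u = g v" using Suc.IH by blast
  show ?case
  proof (cases "w = u")
    case False
    then obtain a b where ab: "a \<noteq> b" "w = peg_swap a b u" using u by (auto elim: moves_cases)
    then have "w = (peg_swap a b \<otimes>\<^bsub>hanoi_group\<^esub> g) v"
      using g by (simp add: hanoi_mult_apply peg_swap_in_hanoi_group)
    with ab g show ?thesis using m_closed peg_swap_in_hanoi_group by blast
  qed (use g in blast)
qed

text \<open>
  The vertex of the Schreier graph that corresponds to the word \<open>v\<close>: the fibre over \<open>v\<close> of the orbit
  map of \<open>1\<^sup>n\<close>.
\<close>

definition fibre :: "nat \<Rightarrow> 3 list \<Rightarrow> (3 list \<Rightarrow> 3 list) set" where
  "fibre n v = {f \<in> carrier hanoi_group. f (replicate n 1) = v}"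

lemma fibre_nonempty:
  assumes "length v = n"
  shows "\<exists>g. g \<in> fibre n v"
proof -
  have "(replicate n 1, v) \<in> moves ^^ corner_dist v 1"
    using relpow_sym[OF moves_sym moves_to_corner[of v 1]] assms by simp
  then show ?thesis using moves_in_orbit by (fastforce simp: fibre_def)
qed

text \<open>All elements of a vertex send \<open>1\<^sup>n\<close> to the same word, so the choice is immaterial.\<close>

definition vertex_word :: "nat \<Rightarrow> (3 list \<Rightarrow> 3 list) set \<Rightarrow> 3 list" where
  "vertex_word n C = (SOME f. f \<in> C) (replicate n 1)"

lemma vertex_word_fibre:
  assumes "length v = n"
  shows "vertex_word n (fibre n v) = v"
proof -
  have "(SOME f. f \<in> fibre n v) \<in> fibre n v"
    using fibre_nonempty[OF assms] by (rule someI_ex)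
  then show ?thesis by (simp add: vertex_word_def fibre_def)
qed

lemma fibre_inj:
  assumes "length v = n" "length w = n" "fibre n v = fibre n w"
  shows "v = w"
  using assms vertex_word_fibre by metis

lemma l_coset_fibre:
  assumes g: "g \<in> carrier hanoi_group"
  shows "g <#\<^bsub>hanoi_group\<^esub> fibre n v = fibre n (g v)"
proof -
  interpret group hanoi_group by (rule group_hanoi_group)
  have "f \<in> (\<lambda>h. g \<otimes>\<^bsub>hanoi_group\<^esub> h) ` fibre n v" if f: "f \<in> fibre n (g v)" for f
  proof
    have "f \<in> carrier hanoi_group" using f by (simp add: fibre_def)
    then show "f = g \<otimes>\<^bsub>hanoi_group\<^esub> (inv\<^bsub>hanoi_group\<^esub> g \<otimes>\<^bsub>hanoi_group\<^esub> f)"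
      using g m_assoc[of g "inv\<^bsub>hanoi_group\<^esub> g" f] by simp
    show "inv\<^bsub>hanoi_group\<^esub> g \<otimes>\<^bsub>hanoi_group\<^esub> f \<in> fibre n v"
      using f g by (simp add: fibre_def hanoi_mult_apply hanoi_inv_apply)
  qed
  moreover have "g \<otimes>\<^bsub>hanoi_group\<^esub> h \<in> fibre n (g v)" if "h \<in> fibre n v" for h
    using that g by (simp add: fibre_def hanoi_mult_apply)
  ultimately show ?thesis unfolding l_coset_def by blast
qed

text \<open>The stabilizer is the fibre over \<open>1\<^sup>n\<close> itself, and every word of length \<open>n\<close> lies in the orbit.\<close>

lemma hanoi_vertices_eq: "hanoi_vertices n = fibre n ` {w. length w = n}"
proof -
  have "hanoi_stab n = fibre n (replicate n 1)"
    by (simp add: hanoi_stab_def stabilizer_def fibre_def)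
  then have "hanoi_vertices n = (\<lambda>g. fibre n (g (replicate n 1))) ` carrier hanoi_group"
    by (auto simp: hanoi_vertices_def LCOSETS_def l_coset_fibre)
  moreover have "(\<lambda>g. g (replicate n 1)) ` carrier hanoi_group = {w. length w = n}"
  proof (intro equalityI subsetI)
    fix w assume "w \<in> {w :: 3 list. length w = n}"
    then obtain g where "g \<in> fibre n w" using fibre_nonempty by blast
    then show "w \<in> (\<lambda>g. g (replicate n 1)) ` carrier hanoi_group"
      unfolding fibre_def by blast
  qed (auto simp: hanoi_length)
  ultimately show ?thesis by (metis image_image)
qed

definition hanoi_edges :: "nat \<Rightarrow> ((3 list \<Rightarrow> 3 list) set \<times> (3 list \<Rightarrow> 3 list) set) set" where
  "hanoi_edges n = {(fibre n w, fibre n (peg_swap a b w)) | w a b. length w = n \<and> a \<noteq> b}"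

lemma hanoi_edgesI: "length w = n \<Longrightarrow> a \<noteq> b \<Longrightarrow> (fibre n w, fibre n (peg_swap a b w)) \<in> hanoi_edges n"
  unfolding hanoi_edges_def by blast

text \<open>Since the generators are involutions, the symmetrization adds no edges.\<close>

lemma schreier_edges_eq: "schreier_edges hanoi_group (hanoi_stab n) hanoi_gens = hanoi_edges n"
proof -
  have "{(C, s <#\<^bsub>hanoi_group\<^esub> C) | C s. C \<in> lcosets\<^bsub>hanoi_group\<^esub> (hanoi_stab n) \<and> s \<in> hanoi_gens} = hanoi_edges n"
    (is "?E = _")
  proof
    show "?E \<subseteq> hanoi_edges n"
      unfolding hanoi_vertices_def[symmetric] hanoi_vertices_eq hanoi_gens_eq
      by (auto simp: l_coset_fibre peg_swap_in_hanoi_group intro!: hanoi_edgesI)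
    show "hanoi_edges n \<subseteq> ?E"
    proof
      fix e assume "e \<in> hanoi_edges n"
      then obtain w a b where w: "length w = n" "a \<noteq> b" "e = (fibre n w, fibre n (peg_swap a b w))"
        unfolding hanoi_edges_def by blast
      then have "e = (fibre n w, peg_swap a b <#\<^bsub>hanoi_group\<^esub> fibre n w)"
        by (simp add: l_coset_fibre peg_swap_in_hanoi_group)
      moreover have "fibre n w \<in> lcosets\<^bsub>hanoi_group\<^esub> (hanoi_stab n)"
        unfolding hanoi_vertices_def[symmetric] hanoi_vertices_eq using w by blast
      moreover have "peg_swap a b \<in> hanoi_gens" using w by (auto simp: hanoi_gens_eq)
      ultimately show "e \<in> ?E" by blast
    qed
  qed
  moreover have "hanoi_edges n \<union> (hanoi_edges n)\<inverse> = hanoi_edges n"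
  proof -
    have "(fibre n (peg_swap a b w), fibre n w) \<in> hanoi_edges n" if "length w = n" "a \<noteq> b" for a b w
      using hanoi_edgesI[of "peg_swap a b w" n a b] that by simp
    then show ?thesis unfolding hanoi_edges_def by blast
  qed
  ultimately show ?thesis by (simp add: schreier_edges_def Let_def)
qed

lemma hanoi_dist_eq: "hanoi_dist n C C' = real (LEAST k. (C, C') \<in> hanoi_edges n ^^ k)"
  by (simp add: hanoi_dist_def path_dist_def schreier_edges_eq)

lemma moves_imp_hanoi_edges:
  assumes "(v, w) \<in> moves ^^ k" "length v = n"
  shows "length w = n \<and> (\<exists>m\<le>k. (fibre n v, fibre n w) \<in> hanoi_edges n ^^ m)"
  using assms(1)
proof (induction k arbitrary: w)
  case 0
  then show ?case using assms(2) by auto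
next
  case (Suc k)
  then obtain u where "(v, u) \<in> moves ^^ k" and u: "(u, w) \<in> moves" by auto
  then obtain m where m: "length u = n" "m \<le> k" "(fibre n v, fibre n u) \<in> hanoi_edges n ^^ m"
    using Suc.IH by blast
  show ?case
  proof (cases "w = u")
    case True
    then show ?thesis using m le_SucI by blast
  next
    case False
    then obtain a b where ab: "a \<noteq> b" "w = peg_swap a b u" using u by (auto elim: moves_cases)
    then have "(fibre n v, fibre n w) \<in> hanoi_edges n ^^ Suc m"
      using m hanoi_edgesI by (meson relpow_Suc_I)
    with ab m show ?thesis by (auto intro!: exI[of _ "Suc m"])
  qed
qed

text \<open>
  Every vertex on a path is again the fibre of a word, and each of its edges changes the
  distances to the corners by at most one.
\<close>

lemma corner_dist_hanoi_edges:
  assumes "(fibre n v, C) \<in> hanoi_edges n ^^ k" "length v = n"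
  shows "\<exists>w. length w = n \<and> C = fibre n w \<and>
           (\<forall>i. \<bar>real (corner_dist v i) - real (corner_dist w i)\<bar> \<le> real k)"
  using assms(1)
proof (induction k arbitrary: C)
  case 0
  then show ?case using assms(2) by auto
next
  case (Suc k)
  then obtain B where B: "(fibre n v, B) \<in> hanoi_edges n ^^ k" "(B, C) \<in> hanoi_edges n" by auto
  then obtain u where u: "length u = n" "B = fibre n u"
      "\<And>i. \<bar>real (corner_dist v i) - real (corner_dist u i)\<bar> \<le> real k"
    using Suc.IH by blast
  from B(2) obtain u' a b where "a \<noteq> b" "B = fibre n u'" "length u' = n" "C = fibre n (peg_swap a b u')"
    unfolding hanoi_edges_def by blast
  with u fibre_inj have ab: "a \<noteq> b" "C = fibre n (peg_swap a b u)" by metis+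
  have "\<bar>real (corner_dist v i) - real (corner_dist (peg_swap a b u) i)\<bar> \<le> real (Suc k)" for i
    using u(3)[of i] corner_dist_peg_swap[OF ab(1), of u i] unfolding of_nat_Suc by linarith
  with u ab show ?case by (intro exI[of _ "peg_swap a b u"]) simp
qed

lemma hanoi_dist_bounds:
  assumes "length v = n" "length w = n"
  shows "\<bar>real (corner_dist v i) - real (corner_dist w i)\<bar> \<le> hanoi_dist n (fibre n v) (fibre n w)"
    and "\<exists>i. hanoi_dist n (fibre n v) (fibre n w) \<le> 2 * \<bar>real (corner_dist v i) - real (corner_dist w i)\<bar>"
    and "v \<noteq> w \<Longrightarrow> 0 < hanoi_dist n (fibre n v) (fibre n w)"
proof -
  define d where "d = (LEAST k. (fibre n v, fibre n w) \<in> hanoi_edges n ^^ k)"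
  obtain i k where k: "(v, w) \<in> moves ^^ k"
      "real k \<le> 2 * \<bar>real (corner_dist v i) - real (corner_dist w i)\<bar>"
    using moves_le_corner_dist_diff[of v w] assms by auto
  obtain m where m: "m \<le> k" "(fibre n v, fibre n w) \<in> hanoi_edges n ^^ m"
    using moves_imp_hanoi_edges[OF k(1) assms(1)] by blast
  have d: "(fibre n v, fibre n w) \<in> hanoi_edges n ^^ d"
    unfolding d_def using m(2) by (rule LeastI)
  have "d \<le> m" unfolding d_def using m(2) by (rule Least_le)
  obtain w' where w': "length w' = n" "fibre n w = fibre n w'"
      "\<And>i. \<bar>real (corner_dist v i) - real (corner_dist w' i)\<bar> \<le> real d"
    using corner_dist_hanoi_edges[OF d assms(1)] by blast
  have "w' = w" using fibre_inj[OF assms(2) w'(1)] w'(2) by blast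
  with w'(3) show "\<bar>real (corner_dist v i) - real (corner_dist w i)\<bar> \<le> hanoi_dist n (fibre n v) (fibre n w)" for i
    unfolding hanoi_dist_eq d_def[symmetric] by blast
  have "real d \<le> real k" using \<open>d \<le> m\<close> m(1) by simp
  with k(2) show "\<exists>i. hanoi_dist n (fibre n v) (fibre n w) \<le> 2 * \<bar>real (corner_dist v i) - real (corner_dist w i)\<bar>"
    unfolding hanoi_dist_eq d_def[symmetric] by (meson order_trans)
  show "0 < hanoi_dist n (fibre n v) (fibre n w)" if "v \<noteq> w"
  proof -
    have "d \<noteq> 0" using d that fibre_inj[OF assms] by (metis relpow_0_E)
    then show ?thesis unfolding hanoi_dist_eq d_def[symmetric] by simp
  qed
qed

section \<open>Embeddings into sequence spaces by finitely many coordinates\<close>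

lemma lp_norm_finite:
  assumes "\<And>k. N \<le> k \<Longrightarrow> u k = 0"
  shows "lp_norm p u = (\<Sum>k<N. \<bar>u k\<bar> powr p) powr (1 / p)"
proof -
  have "(\<Sum>k. \<bar>u k\<bar> powr p) = (\<Sum>k<N. \<bar>u k\<bar> powr p)"
    by (rule suminf_finite) (use assms in auto)
  then show ?thesis by (simp add: lp_norm_def)
qed

lemma abs_le_lp_norm:
  assumes "1 \<le> p" "\<And>k. N \<le> k \<Longrightarrow> u k = 0" "k < N"
  shows "\<bar>u k\<bar> \<le> lp_norm p u"
proof -
  have "\<bar>u k\<bar> powr p \<le> (\<Sum>k<N. \<bar>u k\<bar> powr p)"
    using assms(3) by (intro member_le_sum) auto
  then have "(\<bar>u k\<bar> powr p) powr (1 / p) \<le> (\<Sum>k<N. \<bar>u k\<bar> powr p) powr (1 / p)"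
    using assms(1) by (intro powr_mono2) auto
  then show ?thesis
    using assms(1) lp_norm_finite[of N u p, OF assms(2)] by (simp add: powr_powr)
qed

text \<open>
  The sharp factor is \<open>N powr (1 / p)\<close>; the factor \<open>N\<close> has the advantage that it is independent of
  \<open>p\<close>.
\<close>

lemma lp_norm_le:
  assumes "1 \<le> p" "\<And>k. N \<le> k \<Longrightarrow> u k = 0" "\<And>k. k < N \<Longrightarrow> \<bar>u k\<bar> \<le> B" "0 \<le> B" "1 \<le> N"
  shows "lp_norm p u \<le> real N * B"
proof -
  have "(\<Sum>k<N. \<bar>u k\<bar> powr p) \<le> (\<Sum>k<N. B powr p)"
    using assms by (intro sum_mono powr_mono2) auto
  also have "\<dots> = real N powr 1 * B powr p" by simp
  also have "\<dots> \<le> real N powr p * B powr p"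
    using assms by (intro mult_right_mono powr_mono) auto
  also have "\<dots> = (real N * B) powr p"
    using assms by (simp add: powr_mult)
  finally have "(\<Sum>k<N. \<bar>u k\<bar> powr p) powr (1 / p) \<le> ((real N * B) powr p) powr (1 / p)"
    using assms by (intro powr_mono2 sum_nonneg) auto
  then show ?thesis
    using assms(1,4) lp_norm_finite[of N u p, OF assms(2)] by (simp add: powr_powr)
qed

text \<open>
  Divided by \<open>N\<close>, the coordinates stay below the metric in every \<open>lp\<close>-norm, and a single coordinate
  suffices to bound the norm from below. Two distinct points are required since the
  distortion is a maximum over pairs.
\<close>

lemma lp_distortion_le_coordinates:
  fixes F :: "'v \<Rightarrow> nat \<Rightarrow> real"
  assumes p: "1 \<le> p" and N: "1 \<le> N" and "0 \<le> c"
    and X: "finite X" "x0 \<in> X" "y0 \<in> X" "x0 \<noteq> y0"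
    and pos: "\<And>x y. x \<in> X \<Longrightarrow> y \<in> X \<Longrightarrow> x \<noteq> y \<Longrightarrow> 0 < d x y"
    and upper: "\<And>x y k. x \<in> X \<Longrightarrow> y \<in> X \<Longrightarrow> k < N \<Longrightarrow> \<bar>F x k - F y k\<bar> \<le> d x y"
    and lower: "\<And>x y. x \<in> X \<Longrightarrow> y \<in> X \<Longrightarrow> \<exists>k<N. d x y \<le> c * \<bar>F x k - F y k\<bar>"
  shows "lp_distortion p X d \<le> ereal (c * real N)"
proof -
  define f where "f x k = (if k < N then F x k / real N else 0)" for x k
  have zero: "f x k - f y k = 0" if "N \<le> k" for x y k
    using that by (simp add: f_def)
  have diff: "\<bar>f x k - f y k\<bar> = \<bar>F x k - F y k\<bar> / real N" if "k < N" for x y k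
    using that by (simp add: f_def flip: diff_divide_distrib)
  have up: "lp_dist p (f x) (f y) \<le> d x y" if "x \<in> X" "y \<in> X" for x y
  proof -
    have "0 \<le> d x y" using upper[OF that, of 0] N by simp
    then have "lp_norm p (\<lambda>k. f x k - f y k) \<le> real N * (d x y / real N)"
      using p N zero upper[OF that] by (intro lp_norm_le) (auto simp: diff divide_right_mono)
    then show ?thesis using N by (simp add: lp_dist_def)
  qed
  have low: "d x y \<le> c * real N * lp_dist p (f x) (f y)" if xy: "x \<in> X" "y \<in> X" for x y
  proof -
    obtain k where k: "k < N" "d x y \<le> c * \<bar>F x k - F y k\<bar>" using lower[OF xy] by blast
    have "\<bar>F x k - F y k\<bar> / real N \<le> lp_dist p (f x) (f y)"
      using abs_le_lp_norm[OF p, of N "\<lambda>k. f x k - f y k"] zero k(1) by (simp add: lp_dist_def diff)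
    then have "\<bar>F x k - F y k\<bar> \<le> real N * lp_dist p (f x) (f y)"
      using N by (simp add: field_simps)
    with k(2) \<open>0 \<le> c\<close> show ?thesis
      by (metis mult.assoc mult_left_mono order_trans)
  qed
  have lp_pos: "0 < lp_dist p (f x) (f y)" if "x \<in> X" "y \<in> X" "x \<noteq> y" for x y
  proof -
    have "0 < c * real N * lp_dist p (f x) (f y)" using low pos that by (meson less_le_trans)
    moreover have "0 \<le> c * real N" using \<open>0 \<le> c\<close> by simp
    ultimately show ?thesis by (meson mult_nonneg_nonpos not_less)
  qed
  have "f \<in> lp_embeddings p X d"
  proof -
    have "f x \<in> lp_space p" for x
      unfolding lp_space_def mem_Collect_eq
      by (rule summable_finite[of "{..<N}"]) (auto simp: f_def)
    moreover have "inj_on f X"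
    proof (rule inj_onI, rule ccontr)
      fix x y assume "x \<in> X" "y \<in> X" "f x = f y" "x \<noteq> y"
      then show False using lp_pos[of x y] by (simp add: lp_dist_def lp_norm_def)
    qed
    ultimately show ?thesis using up by (simp add: lp_embeddings_def)
  qed
  then have "lp_distortion p X d \<le> ereal (inv_lipschitz p X d f)"
    unfolding lp_distortion_def by (rule INF_lower)
  also have "inv_lipschitz p X d f \<le> c * real N"
  proof -
    define Q where "Q = {d x y / lp_dist p (f x) (f y) | x y. x \<in> X \<and> y \<in> X \<and> x \<noteq> y}"
    have "Q \<subseteq> (\<lambda>(x, y). d x y / lp_dist p (f x) (f y)) ` (X \<times> X)"
      unfolding Q_def by auto
    from finite_subset[OF this] have "finite Q" using X(1) by simp
    moreover have "d x0 y0 / lp_dist p (f x0) (f y0) \<in> Q"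
      unfolding Q_def using X by blast
    moreover have "r \<le> c * real N" if "r \<in> Q" for r
    proof -
      obtain x y where "x \<in> X" "y \<in> X" "x \<noteq> y" "r = d x y / lp_dist p (f x) (f y)"
        using \<open>r \<in> Q\<close> unfolding Q_def by blast
      then show ?thesis using low lp_pos by (simp add: pos_divide_le_eq)
    qed
    ultimately have "Max Q \<le> c * real N" by (intro Max.boundedI) auto
    then show ?thesis by (simp add: inv_lipschitz_def Q_def)
  qed
  finally show ?thesis by simp
qed

section \<open>The distortion of the Schreier graphs\<close>

theorem theorem11:
  fixes p :: real
  assumes "1 \<le> p"
  shows "\<exists>D::real. \<forall>n\<ge>1. lp_distortion p (hanoi_vertices n) (hanoi_dist n) \<le> ereal D"
proof (intro exI allI impI)
  fix n :: nat assume n: "1 \<le> n"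
  have pegs: "\<exists>k<3. i = of_nat k" for i :: 3
    using peg_cases[of i]
  proof (elim disjE)
    assume "i = 0" then show ?thesis by (intro exI[of _ 0]) simp
  next
    assume "i = 1" then show ?thesis by (intro exI[of _ 1]) simp
  next
    assume "i = 2" then show ?thesis by (intro exI[of _ 2]) simp
  qed
  show "lp_distortion p (hanoi_vertices n) (hanoi_dist n) \<le> ereal (2 * real 3)"
  proof (rule lp_distortion_le_coordinates[OF assms])
    show "finite (hanoi_vertices n)"
      unfolding hanoi_vertices_eq using finite_lists_length_eq[of "UNIV :: 3 set" n] by simp
    show "fibre n (replicate n 0) \<in> hanoi_vertices n" "fibre n (replicate n 1) \<in> hanoi_vertices n"
      by (simp_all add: hanoi_vertices_eq)
    show "fibre n (replicate n 0) \<noteq> fibre n (replicate n 1)"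
      using n fibre_inj[of "replicate n 0" n "replicate n 1"] by (auto simp: replicate_eq_replicate)
  next
    fix C C' assume "C \<in> hanoi_vertices n" "C' \<in> hanoi_vertices n"
    then obtain v w where vw: "length v = n" "length w = n" "C = fibre n v" "C' = fibre n w"
      by (auto simp: hanoi_vertices_eq)
    show "0 < hanoi_dist n C C'" if "C \<noteq> C'"
      using hanoi_dist_bounds(3)[OF vw(1,2)] vw that by auto
    show "\<bar>real (corner_dist (vertex_word n C) (of_nat k)) - real (corner_dist (vertex_word n C') (of_nat k))\<bar>
          \<le> hanoi_dist n C C'" for k
      using hanoi_dist_bounds(1)[OF vw(1,2)] vw by (simp add: vertex_word_fibre)
    show "\<exists>k<3. hanoi_dist n C C' \<le>
       2 * \<bar>real (corner_dist (vertex_word n C) (of_nat k)) - real (corner_dist (vertex_word n C') (of_nat k))\<bar>"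
      using hanoi_dist_bounds(2)[OF vw(1,2)] vw pegs by (metis vertex_word_fibre)
  qed simp_all
qed

end
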